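(* The following hold for positive integers $n$: $g(n,5,1)=\frac59 n$ if $9\mid n$; $g(n,5,2)=\lceil\frac{9}{10}n\rceil$; $g(n,5,s)=n$ for all $s\ge3$; $g(n,6,1)=\frac12 n$ if $4\mid n$; $g(n,6,2)=\frac45 n$ if $10\mid n$; $g(n,6,s)=n$ for all $s\ge3$; $g(n,7,1)=\frac37 n$ if $7\mid n$; $g(n,7,2)=\frac57 n$ if $7\mid n$; $g(n,7,3)=\lceil\frac{34}{35}n\rceil$; $g(n,7,s)=n$ for all $s>3$.
   Context: An $r$-edge colouring of $K_n$ assigns to each edge one of $r$ colours. $g(n,r,s)$ denotes the largest integer $m$ such that in every $r$-edge colouring of $K_n$ there is a set $S$ of at most $s$ colours such that at least $m$ vertices of $K_n$ are incident to at least one edge whose colour lies in $S$.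
   Formalization: The statement is proved for n ≥ 2 rather than all positive integers n: at n = 1 the graph K_1 has no edges, so g(1,r,s) = 0 and claims such as g(n,5,2) = ⌈9n/10⌉ and g(n,5,s) = n fail; the divisibility cases are vacuous there. *)

theory Defs
  imports Complex_Main "HOL-Library.Ramsey" "HOL-Library.FuncSet"
begin

text \<open>\<open>K\<^sub>n\<close> has vertex set \<open>{..<n}\<close>; its edges are the 2-element subsets, \<open>nsets {..<n} 2\<close>.
  A colouring need not use all of the \<open>r\<close> colours.\<close>

definition edge_colouring :: "nat \<Rightarrow> nat \<Rightarrow> (nat set \<Rightarrow> nat) \<Rightarrow> bool" where
  "edge_colouring n r c \<longleftrightarrow> c \<in> nsets {..<n} 2 \<rightarrow> {..<r}"

definition covered :: "nat \<Rightarrow> (nat set \<Rightarrow> nat) \<Rightarrow> nat set \<Rightarrow> nat set" where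
  "covered n c S = {v \<in> {..<n}. \<exists>e \<in> nsets {..<n} 2. v \<in> e \<and> c e \<in> S}"

text \<open>For \<open>r \<ge> 1\<close> the property below holds of \<open>m = 0\<close> and fails for \<open>m > n\<close>, so the largest
  such \<open>m\<close> exists.  For \<open>r = 0\<close> and \<open>n \<ge> 2\<close> there are no colourings and the value is
  unspecified.\<close>

definition g :: "nat \<Rightarrow> nat \<Rightarrow> nat \<Rightarrow> nat" where
  "g n r s = (GREATEST m. \<forall>c. edge_colouring n r c \<longrightarrow>
     (\<exists>S \<subseteq> {..<r}. card S \<le> s \<and> m \<le> card (covered n c S)))"

text \<open>\<open>K\<^sub>1\<close> has no edges, so nothing is covered. This is why \<open>n = 1\<close> must be excluded from
  formulas such as \<open>g n 5 3 = n\<close>.\<close>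

lemma g_one: "g 1 r s = 0"
proof -
  have e: "nsets {..<1} 2 = ({} :: nat set set)"
    by (simp add: nsets_eq_empty)
  have "edge_colouring 1 r c" and "covered 1 c S = {}" for c S
    by (simp_all only: edge_colouring_def covered_def e) auto
  then have "g 1 r s = (GREATEST m. m = (0::nat))"
    unfolding g_def by (auto intro!: arg_cong[where f = Greatest] exI[of _ "{}"])
  then show ?thesis
    by (simp add: Greatest_equality)
qed

end

theory Submission
  imports Defs
begin

text \<open>Only the palette of each vertex, the set of colours at its edges, matters, and the palettes of
  a colouring pairwise intersect. Conversely, every assignment of pairwise intersecting sets to the
  vertices comes from a colouring whose palettes are contained in these sets.

  For the lower bounds: a palette with at most \<open>s\<close> colours is itself a set \<open>S\<close> that covers
  everything; if all palettes are larger, average the coverage over all \<open>s\<close>-sets of colours. For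
  \<open>s = 1\<close>, a palette with two colours has a colour covering half of the vertices, and with five
  colours a weighted average over the colours is needed; its weights depend on which pairs of colours
  are palettes. The upper bounds distribute the vertices evenly over the blocks of an intersecting
  family: all \<open>k\<close>-sets of \<open>2 k - 1\<close> points, the stars of \<open>K\<^sub>4\<close>, the 2-(6,3,2) design, the Fano plane,
  or, for five colours and \<open>s = 1\<close>, the extremal weighted family.\<close>

section \<open>Palettes and general bounds on \<open>g\<close>\<close>

definition palette :: "nat \<Rightarrow> (nat set \<Rightarrow> nat) \<Rightarrow> nat \<Rightarrow> nat set" where
  "palette n c v = c ` {e \<in> nsets {..<n} 2. v \<in> e}"

lemma covered_eq_palette: "covered n c S = {v \<in> {..<n}. palette n c v \<inter> S \<noteq> {}}"
  unfolding covered_def palette_def by auto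

lemma card_covered_le: "card (covered n c S) \<le> n"
proof -
  have "card (covered n c S) \<le> card {..<n}"
    by (rule card_mono) (auto simp: covered_def)
  then show ?thesis by simp
qed

lemma palette_subset: "edge_colouring n r c \<Longrightarrow> palette n c v \<subseteq> {..<r}"
  unfolding edge_colouring_def palette_def by auto

text \<open>The colour of the edge joining \<open>u\<close> and \<open>v\<close> lies in both
  palettes. For \<open>u = v\<close>, any second vertex gives an edge, so palettes are nonempty;
  \<open>n \<ge> 2\<close> supplies that vertex.\<close>

lemma palette_intersect:
  assumes "n \<ge> 2" "u < n" "v < n"
  shows "palette n c u \<inter> palette n c v \<noteq> {}"
proof -
  obtain w where w: "w < n" "w \<noteq> u" "u \<noteq> v \<longrightarrow> w = v"
  proof (cases "u = v")
    case True
    then show ?thesis using that[of "if u = 0 then 1 else 0"] assms by auto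
  next
    case False
    then show ?thesis using that[of v] assms by auto
  qed
  have "{u, w} \<in> nsets {..<n} 2" "v \<in> {u, w}"
    using w assms by (auto simp: nsets_def)
  then show ?thesis unfolding palette_def by blast
qed

lemma g_ge:
  assumes "r > 0"
    and "\<And>c. edge_colouring n r c \<Longrightarrow> \<exists>S \<subseteq> {..<r}. card S \<le> s \<and> m \<le> card (covered n c S)"
  shows "m \<le> g n r s"
  unfolding g_def
proof (rule Greatest_le_nat[where b = n])
  \<comment> \<open>\<open>GREATEST\<close> is meaningful only if the candidates are bounded. One
    existing colouring bounds them all by \<open>n\<close>; with no colouring every number would
    qualify vacuously.\<close>
  have "edge_colouring n r (\<lambda>_. 0)" using assms(1) by (auto simp: edge_colouring_def)
  then show "k \<le> n" if "\<forall>c. edge_colouring n r c \<longrightarrow>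
      (\<exists>S \<subseteq> {..<r}. card S \<le> s \<and> k \<le> card (covered n c S))" for k
    using that card_covered_le le_trans by blast
qed (use assms(2) in blast)

lemma g_le:
  assumes "edge_colouring n r c"
    and "\<And>S. S \<subseteq> {..<r} \<Longrightarrow> card S \<le> s \<Longrightarrow> card (covered n c S) \<le> m"
  shows "g n r s \<le> m"
proof -
  let ?P = "\<lambda>k. \<forall>c. edge_colouring n r c \<longrightarrow>
      (\<exists>S \<subseteq> {..<r}. card S \<le> s \<and> k \<le> card (covered n c S))"
  have b: "\<And>k. ?P k \<Longrightarrow> k \<le> m" using assms le_trans by blast
  have "?P 0" by (auto intro: exI[of _ "{}"])
  then have "?P (GREATEST k. ?P k)" using b by (rule GreatestI_nat)
  then show ?thesis unfolding g_def by (rule b)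
qed

lemma g_le_n:
  assumes "r > 0"
  shows "g n r s \<le> n"
proof (rule g_le)
  show "edge_colouring n r (\<lambda>_. 0)" using assms by (auto simp: edge_colouring_def)
qed (rule card_covered_le)

section \<open>Lower bounds by averaging\<close>

text \<open>Double counting: in the weighted sum of the coverages, each vertex contributes the
  weight of the indices whose sets meet its palette, hence at least \<open>p\<close>. Some coverage
  reaches the weighted mean. Natural weights and a cleared denominator avoid fractions.\<close>

lemma covered_weighted_average:
  fixes w :: "'i \<Rightarrow> nat"
  assumes "finite I" "sum w I > 0"
    and "\<And>v. v < n \<Longrightarrow> p \<le> sum w {i \<in> I. palette n c v \<inter> S i \<noteq> {}}"
  shows "\<exists>i \<in> I. p * n \<le> sum w I * card (covered n c (S i))"
proof (rule ccontr)
  let ?d = "\<lambda>i. card (covered n c (S i))"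
  assume "\<not> ?thesis"
  then have less: "\<And>i. i \<in> I \<Longrightarrow> sum w I * ?d i < p * n" by (auto simp: not_le)
  have d: "?d i = (\<Sum>v<n. if palette n c v \<inter> S i \<noteq> {} then 1 else 0)" for i
    unfolding covered_eq_palette by (subst sum.inter_filter[symmetric]) auto
  have "(\<Sum>i\<in>I. w i * ?d i)
      = (\<Sum>i\<in>I. \<Sum>v<n. if palette n c v \<inter> S i \<noteq> {} then w i else 0)"
    unfolding d sum_distrib_left by (intro sum.cong refl) auto
  also have "\<dots> = (\<Sum>v<n. \<Sum>i\<in>I. if palette n c v \<inter> S i \<noteq> {} then w i else 0)"
    by (rule sum.swap)
  also have "\<dots> = (\<Sum>v<n. sum w {i \<in> I. palette n c v \<inter> S i \<noteq> {}})"
    using assms(1) by (simp add: sum.inter_filter)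
  also have "\<dots> \<ge> (\<Sum>v<n. p)"
    using assms(3) by (intro sum_mono) auto
  finally have "p * n \<le> (\<Sum>i\<in>I. w i * ?d i)" by (simp add: mult.commute)
  then have "sum w I * (p * n) \<le> sum w I * (\<Sum>i\<in>I. w i * ?d i)" by (rule mult_le_mono2)
  also have "\<dots> = (\<Sum>i\<in>I. w i * (sum w I * ?d i))"
    by (subst sum_distrib_left) (simp add: mult.left_commute)
  also have "\<dots> < (\<Sum>i\<in>I. w i * (p * n))"
  \<comment> \<open>Indices of weight 0 give only equality; strictness comes from one index of
    positive weight.\<close>
  proof (rule sum_strict_mono_ex1[OF assms(1)])
    obtain i where "i \<in> I" "w i > 0"
      using assms(2) by (metis gr0I less_irrefl sum.neutral)
    then show "\<exists>i\<in>I. w i * (sum w I * ?d i) < w i * (p * n)"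
      using less by (intro bexI[of _ i]) auto
  qed (use less in \<open>auto intro: less_imp_le\<close>)
  finally show False by (simp add: sum_distrib_right)
qed

text \<open>Average over all \<open>s\<close>-sets with weight 1. Those that miss a palette are
  exactly the \<open>s\<close>-subsets of its complement, which has at most \<open>r - k\<close>
  colours.\<close>

lemma covered_average:
  assumes c: "edge_colouring n r c" and "s \<le> r"
    and k: "\<And>v. v < n \<Longrightarrow> k \<le> card (palette n c v)"
  shows "\<exists>S \<subseteq> {..<r}. card S = s
    \<and> ((r choose s) - ((r - k) choose s)) * n \<le> (r choose s) * card (covered n c S)"
proof -
  let ?I = "nsets {..<r} s"
  have card_I: "card ?I = r choose s" by (simp add: card_nsets)
  have "(r choose s) - ((r - k) choose s) \<le> (\<Sum>S\<in>{S \<in> ?I. palette n c v \<inter> S \<noteq> {}}. 1)"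
    if "v < n" for v
  proof -
    let ?A = "palette n c v"
    have A: "?A \<subseteq> {..<r}" using palette_subset[OF c] .
    have "{S \<in> ?I. ?A \<inter> S \<noteq> {}} = ?I - nsets ({..<r} - ?A) s"
      by (auto simp: nsets_def)
    moreover have "nsets ({..<r} - ?A) s \<subseteq> ?I" by (auto simp: nsets_def)
    moreover have "card (nsets ({..<r} - ?A) s) = (r - card ?A) choose s"
      using A finite_subset[OF A] by (simp add: card_nsets card_Diff_subset)
    moreover have "(r - card ?A) choose s \<le> (r - k) choose s"
      using k[OF that] by (intro binomial_right_mono diff_le_mono2)
    ultimately show ?thesis
      by (simp add: card_Diff_subset finite_imp_finite_nsets finite_subset card_I)
  qed
  then have "\<exists>S\<in>?I. ((r choose s) - ((r - k) choose s)) * n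
      \<le> (\<Sum>S\<in>?I. 1) * card (covered n c S)"
    using assms(2) by (intro covered_weighted_average)
      (auto simp: finite_imp_finite_nsets card_I)
  then obtain S where "S \<in> ?I"
    "((r choose s) - ((r - k) choose s)) * n \<le> (r choose s) * card (covered n c S)"
    by (auto simp: card_I)
  then show ?thesis by (auto simp: nsets_def)
qed

lemma covered_palette:
  assumes "n \<ge> 2" "v < n"
  shows "card (covered n c (palette n c v)) = n"
proof -
  have "covered n c (palette n c v) = {..<n}"
    using palette_intersect[OF assms(1) _ assms(2)] by (auto simp: covered_eq_palette)
  then show ?thesis by simp
qed

text \<open>Either some palette has at most \<open>t\<close> colours and covers everything, or all
  have at least \<open>t + 1\<close> and averaging over \<open>t\<close>-sets applies. The strict
  inequality with the extra \<open>r choose t\<close> says that \<open>m\<close> is at most the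
  average rounded up. Allowing \<open>t < s\<close> lets a single \<open>t\<close> serve all larger
  \<open>s\<close>.\<close>

lemma g_ge_binomial:
  assumes "n \<ge> 2" "r > 0" "t \<le> r" "t \<le> s"
    and "(r choose t) * m < ((r choose t) - ((r - Suc t) choose t)) * n + (r choose t)"
    and "m \<le> n"
  shows "m \<le> g n r s"
proof (rule g_ge[OF assms(2)])
  fix c assume c: "edge_colouring n r c"
  show "\<exists>S\<subseteq>{..<r}. card S \<le> s \<and> m \<le> card (covered n c S)"
  proof (cases "\<exists>v<n. card (palette n c v) \<le> t")
    case True
    then obtain v where v: "v < n" "card (palette n c v) \<le> t" by blast
    then show ?thesis
      using covered_palette[OF assms(1) v(1), of c] palette_subset[OF c, of v] assms(4,6)
      by (intro exI[of _ "palette n c v"]) auto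
  next
    case False
    then have "\<And>v. v < n \<Longrightarrow> Suc t \<le> card (palette n c v)" by auto
    from covered_average[OF c assms(3) this] obtain S where S: "S \<subseteq> {..<r}" "card S = t"
      "((r choose t) - ((r - Suc t) choose t)) * n \<le> (r choose t) * card (covered n c S)"
      by blast
    have "(r choose t) * m < (r choose t) * Suc (card (covered n c S))"
      using assms(5) S(3) by simp
    then have "m \<le> card (covered n c S)" using mult_less_cancel1 less_Suc_eq_le by blast
    then show ?thesis using S assms(4) by auto
  qed
qed

text \<open>Average over the colours of this one palette only: every other palette meets it, so each
  vertex counts at least once among at most two colours.\<close>

lemma covered_half:
  assumes "n \<ge> 2" "v < n" "card (palette n c v) \<le> 2"
  shows "\<exists>i \<in> palette n c v. n \<le> 2 * card (covered n c {i})"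
proof -
  let ?A = "palette n c v"
  have fin: "finite ?A"
    unfolding palette_def by (simp add: finite_imp_finite_nsets)
  have ne: "?A \<noteq> {}" using palette_intersect[OF assms(1,2,2)] by auto
  have "\<exists>i\<in>?A. 1 * n \<le> (\<Sum>i\<in>?A. 1) * card (covered n c {i})"
  proof (rule covered_weighted_average[OF fin])
    show "(\<Sum>i\<in>?A. 1) > (0 :: nat)" using fin ne by (simp add: card_gt_0_iff)
  next
    fix u assume "u < n"
    then have "palette n c u \<inter> ?A \<noteq> {}" using palette_intersect assms by blast
    then have "{i \<in> ?A. palette n c u \<inter> {i} \<noteq> {}} \<noteq> {}" by auto
    then show "1 \<le> (\<Sum>i\<in>{i \<in> ?A. palette n c u \<inter> {i} \<noteq> {}}. 1 :: nat)"
      using fin by (simp add: Suc_le_eq card_gt_0_iff)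
  qed
  then show ?thesis using assms(3)
    by (metis card_eq_sum le_trans mult.left_neutral mult_le_mono1)
qed

text \<open>A palette with at most two colours yields half of the vertices, which is at least
  \<open>3 * n / r\<close> because \<open>r \<ge> 6\<close>; otherwise every palette has three
  colours and the plain average suffices. With five colours 1/2 falls short of 3/5, hence the
  separate treatment below.\<close>

lemma g_one_ge:
  assumes "n \<ge> 2" "r \<ge> 6" "r * m \<le> 3 * n"
  shows "m \<le> g n r 1"
proof (rule g_ge)
  fix c assume c: "edge_colouring n r c"
  show "\<exists>S\<subseteq>{..<r}. card S \<le> 1 \<and> m \<le> card (covered n c S)"
  proof (cases "\<exists>v<n. card (palette n c v) \<le> 2")
    case True
    then obtain v i where vi: "i \<in> palette n c v" "n \<le> 2 * card (covered n c {i})"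
      using covered_half[OF assms(1)] by blast
    have "6 * m \<le> r * m" using assms(2) by simp
    then have "m \<le> card (covered n c {i})" using vi assms(3) by linarith
    then show ?thesis using vi palette_subset[OF c, of v] by (intro exI[of _ "{i}"]) auto
  next
    case False
    then have "\<And>v. v < n \<Longrightarrow> 3 \<le> card (palette n c v)" by force
    from covered_average[OF c _ this, of 1] obtain S where
      S: "S \<subseteq> {..<r}" "card S = 1" "3 * n \<le> r * card (covered n c S)"
      using assms(2) by auto
    have "r * m \<le> r * card (covered n c S)" using S(3) assms(3) by linarith
    then show ?thesis using S assms(2) by auto
  qed
qed (use assms in auto)

section \<open>Five colours and one chosen colour: weights for intersecting families\<close>

text \<open>The weighting gives each member at least 5/9 of the total. It is chosen according to
  which pairs belong to \<open>F\<close>: uniform if all members have three points, concentrated on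
  a point if a singleton occurs, and otherwise adapted to the pairs present.\<close>

lemma intersecting_five_weights:
  assumes V: "card V = 5" "\<And>X. X \<in> F \<Longrightarrow> X \<subseteq> V"
    and inter: "\<And>X Y. X \<in> F \<Longrightarrow> Y \<in> F \<Longrightarrow> X \<inter> Y \<noteq> {}"
  shows "\<exists>w :: 'a \<Rightarrow> nat. sum w V > 0 \<and> (\<forall>X\<in>F. 5 * sum w V \<le> 9 * sum w X)"
proof -
  have "finite V" using V(1) by (metis card.infinite zero_neq_numeral)
  have fin: "finite X" if "X \<in> F" for X using V(2)[OF that] \<open>finite V\<close> finite_subset by blast
  consider (large) "\<forall>X\<in>F. card X \<ge> 3" | (one) "\<exists>X\<in>F. card X = 1"
    | (two) "\<exists>X\<in>F. card X = 2" "\<forall>X\<in>F. card X \<noteq> 1"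
  proof -
    have "card X \<noteq> 0" if "X \<in> F" for X using inter[OF that that] fin[OF that] by auto
    then have "card X \<ge> 3 \<or> card X = 1 \<or> card X = 2" if "X \<in> F" for X
      using that by (metis One_nat_def Suc_1 le_less_linear less_Suc_eq less_one numeral_3_eq_3)
    then show ?thesis using that by blast
  qed
  then show ?thesis
  proof cases
    case large
    then show ?thesis using V(1) by (intro exI[of _ "\<lambda>_. 1"]) auto
  next
    case one
    then obtain a where a: "{a} \<in> F" by (auto simp: card_1_singleton_iff)
    have "a \<in> V" using V(2)[OF a] by simp
    moreover have "a \<in> X" if "X \<in> F" for X using inter[OF that a] by auto
    ultimately show ?thesis using fin \<open>finite V\<close>
      by (intro exI[of _ "\<lambda>i. if i = a then 1 else 0"]) auto
  next
    case two
    note no1 = two(2)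
    have five: "\<exists>d e. V = {a, b, c, d, e} \<and> distinct [a, b, c, d, e]"
      if "a \<in> V" "b \<in> V" "c \<in> V" "distinct [a, b, c]" for a b c
    proof -
      have "card (V - {a, b, c}) = 2" using that V(1) by (subst card_Diff_subset) auto
      then obtain d e where de: "V - {a, b, c} = {d, e}" "d \<noteq> e" by (auto simp: card_2_iff)
      have "V = {a, b, c} \<union> (V - {a, b, c})" using that(1-3) by blast
      then have "V = {a, b, c, d, e}" unfolding de(1) by (simp add: insert_commute)
      moreover have "d \<notin> {a, b, c}" "e \<notin> {a, b, c}" using de(1) by blast+
      then have "distinct [a, b, c, d, e]" using that(4) de(2) by auto
      ultimately show ?thesis by blast
    qed
    \<comment> \<open>Once \<open>V\<close> is listed, this turns each weight of \<open>X\<close>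
      into five terms decided by membership.\<close>
    have sumX: "sum w X = (\<Sum>i\<in>V. if i \<in> X then w i else 0)" if "X \<in> F" for X and w :: "'a \<Rightarrow> nat"
      using V(2)[OF that] \<open>finite V\<close> by (simp add: sum.inter_restrict[symmetric] Int_absorb1)
    from two obtain a b where ab: "{a, b} \<in> F" "a \<noteq> b" by (auto simp: card_2_iff)
    show ?thesis
    proof (cases "\<exists>Y\<in>F. card Y = 2 \<and> Y \<noteq> {a, b}")
      case False
      obtain c where c: "c \<in> V" "c \<noteq> a" "c \<noteq> b"
      proof -
        have "\<not> V \<subseteq> {a, b}" using V(1) ab(2) card_mono[of "{a, b}" V] by auto
        then show ?thesis using that by auto
      qed
      obtain d e where V5: "V = {a, b, c, d, e}" "distinct [a, b, c, d, e]"
        using five[of a b c] V(2)[OF ab(1)] ab c by auto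
      \<comment> \<open>The total is 7, so weight 4 is enough: \<open>X\<close> contains both
        \<open>a\<close> and \<open>b\<close>, or one of them and two further points.\<close>
      define w where "w = (\<lambda>_. 1 :: nat)(a := 2, b := 2)"
      have "5 * sum w V \<le> 9 * sum w X" if X: "X \<in> F" for X
      proof -
        have "a \<in> X \<or> b \<in> X" using inter[OF X ab(1)] by auto
        moreover have "a \<in> X \<and> b \<in> X \<or> card X \<ge> 3"
        proof (cases "card X = 2")
          case True
          then show ?thesis using False X by auto
        next
          case False
          then show ?thesis using no1 X inter[OF X X] fin[OF X]
            by (metis One_nat_def Suc_1 Suc_leI card_gt_0_iff inf.idem le_neq_implies_less numeral_3_eq_3)
        qed
        moreover have "card X = sum (\<lambda>_. 1) X" by simp
        ultimately show ?thesis
          unfolding sumX[OF X] using V5 by (auto simp: w_def split: if_splits)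
      qed
      moreover have "sum w V > 0" using V5 by (simp add: w_def)
      ultimately show ?thesis by blast
    next
      case True
      then obtain Y where Y: "Y \<in> F" "card Y = 2" "Y \<noteq> {a, b}" by blast
      \<comment> \<open>Two distinct intersecting pairs share exactly one point, which is renamed
        \<open>a\<close>.\<close>
      have "\<exists>a b c. {a, b} \<in> F \<and> {a, c} \<in> F \<and> distinct [a, b, c]"
      proof -
        obtain x y where xy: "Y = {x, y}" "x \<noteq> y" using Y(2) by (auto simp: card_2_iff)
        have pairs: "{b, a} \<in> F" "{x, y} \<in> F" "{y, x} \<in> F"
          using ab(1) Y(1) xy(1) by (simp_all add: insert_commute)
        consider "x = a" "y \<noteq> b" | "x = b" "y \<noteq> a" | "y = a" "x \<noteq> b" | "y = b" "x \<noteq> a"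
          using inter[OF Y(1) ab(1)] xy(1) Y(3) by blast
        then show ?thesis
        proof cases
          case 1
          then have "{a, b} \<in> F \<and> {a, y} \<in> F \<and> distinct [a, b, y]" using pairs xy(2) ab by simp
          then show ?thesis by blast
        next
          case 2
          then have "{b, a} \<in> F \<and> {b, y} \<in> F \<and> distinct [b, a, y]" using pairs xy(2) ab by simp
          then show ?thesis by blast
        next
          case 3
          then have "{a, b} \<in> F \<and> {a, x} \<in> F \<and> distinct [a, b, x]" using pairs xy(2) ab by simp
          then show ?thesis by blast
        next
          case 4
          then have "{b, a} \<in> F \<and> {b, x} \<in> F \<and> distinct [b, a, x]" using pairs xy(2) ab by simp
          then show ?thesis by blast
        qed
      qed
      then obtain a b c where abc: "{a, b} \<in> F" "{a, c} \<in> F" "distinct [a, b, c]" by blast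
      obtain d e where V5: "V = {a, b, c, d, e}" "distinct [a, b, c, d, e]"
        using five[of a b c] V(2)[OF abc(1)] V(2)[OF abc(2)] abc by auto
      have X1: "a \<in> X \<or> b \<in> X \<and> c \<in> X" if "X \<in> F" for X
        using inter[OF that abc(1)] inter[OF that abc(2)] by auto
      have X2: "X \<noteq> {x}" if "X \<in> F" for X x using no1 that by auto
      have X3: "b \<in> X \<or> c \<in> X \<or> d \<in> X \<or> e \<in> X" if "X \<in> F" for X
      proof (rule ccontr)
        assume "\<not> ?thesis"
        then have "X = {a}" using X1[OF that] V(2)[OF that] unfolding V5(1) by blast
        then show False using X2[OF that] by blast
      qed
      define good where "good w \<longleftrightarrow> sum w V > 0 \<and> (\<forall>X\<in>F. 5 * sum w V \<le> 9 * sum w X)"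
        for w :: "'a \<Rightarrow> nat"
      have "\<exists>w. good w"
      proof (cases "{b, c} \<in> F")
        case True
        \<comment> \<open>Three pairs form a triangle, and every member contains two of its three
          corners: a share of 2/3.\<close>
        have "good ((\<lambda>_. 0)(a := 1, b := 1, c := 1))"
          unfolding good_def
        proof (intro conjI ballI)
          fix X assume X: "X \<in> F"
          have "a \<in> X \<or> b \<in> X \<and> c \<in> X" "b \<in> X \<or> c \<in> X" using X1[OF X] inter[OF X True] by auto
          then show "5 * sum ((\<lambda>_. 0)(a := 1, b := 1, c := 1)) V
              \<le> 9 * sum ((\<lambda>_. 0)(a := 1, b := 1, c := (1::nat))) X"
            unfolding sumX[OF X] using V5 by auto
        qed (use V5 in simp)
        then show ?thesis by blast
      next
        case False
        have bc: "a \<in> X \<or> d \<in> X \<or> e \<in> X" if "X \<in> F" for X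
        proof -
          have "X \<noteq> {b, c}" using False that by auto
          then show ?thesis using X1[OF that] V(2)[OF that] unfolding V5(1) by blast
        qed
        \<comment> \<open>Kept general in \<open>d\<close> and \<open>e\<close>, since it is used
          with both orders. The total is 5 and each member has weight at least 3: it contains
          \<open>a\<close> and one of \<open>b\<close>, \<open>c\<close>, \<open>d\<close>, or else
          all of these three.\<close>
        have star: "\<exists>w. good w" if V5: "V = {a, b, c, d, e}" "distinct [a, b, c, d, e]"
          and d: "{a, d} \<in> F" and e: "{a, e} \<notin> F" for d e
        proof -
          have "good ((\<lambda>_. 0)(a := 2, b := 1, c := 1, d := 1))"
            unfolding good_def
          proof (intro conjI ballI)
            fix X assume X: "X \<in> F"
            have "a \<in> X \<or> d \<in> X" using inter[OF X d] by auto
            moreover have "b \<in> X \<or> c \<in> X \<or> d \<in> X"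
            proof -
              have "X \<noteq> {a, e}" using e X by auto
              then show ?thesis using X2[OF X, of a] X1[OF X] V(2)[OF X] unfolding V5(1) by blast
            qed
            ultimately show "5 * sum ((\<lambda>_. 0)(a := 2, b := 1, c := 1, d := 1)) V
                \<le> 9 * sum ((\<lambda>_. 0)(a := 2, b := 1, c := 1, d := (1::nat))) X"
              unfolding sumX[OF X] using V5 X1[OF X] by auto
          qed (use V5 in simp)
          then show ?thesis by blast
        qed
        consider (de) "{a, d} \<in> F" "{a, e} \<in> F" | (d) "{a, d} \<in> F" "{a, e} \<notin> F"
          | (e) "{a, d} \<notin> F" "{a, e} \<in> F" | (none) "{a, d} \<notin> F" "{a, e} \<notin> F" by blast
        then show ?thesis
        proof cases
          case d then show ?thesis using star[of d e] V5 by auto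
        next
          case e then show ?thesis using star[of e d] V5 by (auto simp: insert_commute)
        next
          case de
          \<comment> \<open>All four pairs through \<open>a\<close> are present, so a member
            contains \<open>a\<close> and another point, or all four other points: weight 4 out of
            7.\<close>
          have "good ((\<lambda>_. 1)(a := 3))"
            unfolding good_def
          proof (intro conjI ballI)
            fix X assume X: "X \<in> F"
            have "a \<in> X \<or> d \<in> X" "a \<in> X \<or> e \<in> X" using inter[OF X de(1)] inter[OF X de(2)] by auto
            then show "5 * sum ((\<lambda>_. 1)(a := 3)) V \<le> 9 * sum ((\<lambda>_. 1)(a := (3::nat))) X"
              unfolding sumX[OF X] using V5 X1[OF X] X3[OF X] by auto
          qed (use V5 in simp)
          then show ?thesis by blast
        next
          case none
          \<comment> \<open>The tight case, total 9. The lightest possible members, such as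
            \<open>{a, b}\<close>, \<open>{a, d, e}\<close> and \<open>{b, c, d}\<close>, have
            weight exactly 5; they are the blocks of the extremal family in
            \<open>g_five_one_le\<close>.\<close>
          have "good ((\<lambda>_. 1)(a := 3, b := 2, c := 2))"
            unfolding good_def
          proof (intro conjI ballI)
            fix X assume X: "X \<in> F"
            have "X \<noteq> {a, d}" "X \<noteq> {a, e}" using none X by auto
            then have "b \<in> X \<or> c \<in> X \<or> (d \<in> X \<and> e \<in> X)"
              using X2[OF X, of a] X1[OF X] V(2)[OF X] unfolding V5(1) by blast
            then show "5 * sum ((\<lambda>_. 1)(a := 3, b := 2, c := 2)) V
                \<le> 9 * sum ((\<lambda>_. 1)(a := 3, b := 2, c := (2::nat))) X"
              unfolding sumX[OF X] using V5 X1[OF X] bc[OF X] by auto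
          qed (use V5 in simp)
          then show ?thesis by blast
        qed
      qed
      then show ?thesis by (simp add: good_def)
    qed
  qed
qed

lemma g_five_one_ge:
  assumes "n \<ge> 2" "9 * m \<le> 5 * n"
  shows "m \<le> g n 5 1"
proof (rule g_ge)
  fix c assume c: "edge_colouring n 5 c"
  have "\<exists>w :: nat \<Rightarrow> nat. sum w {..<5} > 0
      \<and> (\<forall>X\<in>palette n c ` {..<n}. 5 * sum w {..<5} \<le> 9 * sum w X)"
    using palette_subset[OF c] palette_intersect[OF assms(1)]
    by (intro intersecting_five_weights) auto
  then obtain w :: "nat \<Rightarrow> nat" where w: "sum w {..<5} > 0"
    "\<And>v. v < n \<Longrightarrow> 5 * sum w {..<5} \<le> 9 * sum w (palette n c v)"
    by auto
  \<comment> \<open>The weights are scaled by 9 to match the inequality for palettes; the total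
    weight cancels afterwards.\<close>
  have "\<exists>i\<in>{..<5}. 5 * sum w {..<5} * n
      \<le> (\<Sum>i<5. 9 * w i) * card (covered n c {i})"
  proof (rule covered_weighted_average)
    fix v assume "v < n"
    have "{i \<in> {..<5}. palette n c v \<inter> {i} \<noteq> {}} = palette n c v"
      using palette_subset[OF c, of v] by auto
    then show "5 * sum w {..<5} \<le> (\<Sum>i\<in>{i \<in> {..<5}. palette n c v \<inter> {i} \<noteq> {}}. 9 * w i)"
      using w(2)[OF \<open>v < n\<close>] by (simp add: sum_distrib_left)
  qed (use w(1) in \<open>simp_all add: sum_distrib_left[symmetric]\<close>)
  then obtain i where i: "i < 5"
    "sum w {..<5} * (5 * n) \<le> sum w {..<5} * (9 * card (covered n c {i}))"
    unfolding sum_distrib_left[symmetric] mult.assoc mult.left_commute[of 5] mult.left_commute[of 9]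
    by blast
  then have "5 * n \<le> 9 * card (covered n c {i})" using w(1) by simp
  then have "m \<le> card (covered n c {i})" using assms(2) by linarith
  then show "\<exists>S\<subseteq>{..<5}. card S \<le> 1 \<and> m \<le> card (covered n c S)"
    using i(1) by (intro exI[of _ "{i}"]) auto
qed simp

section \<open>Upper bounds from intersecting block families\<close>

lemma card_residue_class_ge:
  assumes "i < (N :: nat)"
  shows "n div N \<le> card {v \<in> {..<n}. v mod N = i}"
proof -
  have "k * N + i < n" if "k < n div N" for k
  proof -
    have "Suc k * N \<le> n div N * N" using that by (intro mult_le_mono1) simp
    also have "\<dots> \<le> n" by simp
    finally show ?thesis using assms by simp
  qed
  then have "(\<lambda>k. k * N + i) ` {..<n div N} \<subseteq> {v \<in> {..<n}. v mod N = i}"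
    using assms by auto
  then have "card ((\<lambda>k. k * N + i) ` {..<n div N}) \<le> card {v \<in> {..<n}. v mod N = i}"
    by (intro card_mono) auto
  moreover have "inj_on (\<lambda>k. k * N + i) {..<n div N}" using assms by (auto simp: inj_on_def)
  ultimately show ?thesis by (simp add: card_image)
qed

text \<open>Vertex \<open>v\<close> receives the block with index \<open>v mod N\<close>, and an
  edge takes a colour common to the blocks of its ends. Palettes then lie inside blocks, so every
  block disjoint from \<open>S\<close> leaves a whole residue class uncovered, of size at least
  \<open>n div N\<close>.\<close>

lemma g_le_blocks:
  assumes "N > 0" and B: "\<And>i. i < N \<Longrightarrow> B i \<subseteq> {..<r}"
    and inter: "\<And>i j. i < N \<Longrightarrow> j < N \<Longrightarrow> B i \<inter> B j \<noteq> {}"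
    and missed: "\<And>S. S \<subseteq> {..<r} \<Longrightarrow> card S \<le> s \<Longrightarrow> u \<le> card {i \<in> {..<N}. B i \<inter> S = {}}"
  shows "g n r s \<le> n - u * (n div N)"
proof -
  define c where "c e = (SOME x. x \<in> (\<Inter>v\<in>e. B (v mod N)))" for e
  have c: "c e \<in> (\<Inter>v\<in>e. B (v mod N))" if e: "e \<in> nsets {..<n} 2" for e
  proof -
    obtain x y where "e = {x, y}" using e by (auto simp: nsets_def card_2_iff)
    \<comment> \<open>Both ends may lie in the same residue class; \<open>inter\<close> with
      \<open>i = j\<close> then says that the block is nonempty.\<close>
    moreover have "B (x mod N) \<inter> B (y mod N) \<noteq> {}" using inter assms(1) by simp
    ultimately have "\<exists>x. x \<in> (\<Inter>v\<in>e. B (v mod N))" by auto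
    then show ?thesis unfolding c_def by (rule someI_ex)
  qed
  show ?thesis
  proof (rule g_le)
    show "edge_colouring n r c"
      unfolding edge_colouring_def
    proof
      fix e assume e: "e \<in> nsets {..<n} 2"
      then obtain x where "x \<in> e" by (auto simp: nsets_def card_2_iff)
      then show "c e \<in> {..<r}" using c[OF e] B[of "x mod N"] assms(1) by auto
    qed
  next
    fix S assume S: "S \<subseteq> {..<r}" "card S \<le> s"
    let ?I = "{i \<in> {..<N}. B i \<inter> S = {}}"
    let ?M = "\<Union>i\<in>?I. {v \<in> {..<n}. v mod N = i}"
    have "u * (n div N) \<le> card ?I * (n div N)" using missed[OF S] by simp
    also have "\<dots> \<le> (\<Sum>i\<in>?I. card {v \<in> {..<n}. v mod N = i})"
      using sum_mono[of ?I "\<lambda>_. n div N"] card_residue_class_ge by simp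
    also have "\<dots> = card ?M" by (subst card_UN_disjoint) auto
    finally have "u * (n div N) \<le> card ?M" .
    moreover have "covered n c S \<subseteq> {..<n} - ?M"
      unfolding covered_def using c by fastforce
    then have "card (covered n c S) \<le> card ({..<n} - ?M)" by (rule card_mono[rotated]) simp
    moreover have "card ({..<n} - ?M) = n - card ?M" by (subst card_Diff_subset) auto
    ultimately show "card (covered n c S) \<le> n - u * (n div N)" by simp
  qed
qed

text \<open>Take all \<open>k\<close>-sets as blocks: two of them cannot be disjoint within fewer
  than \<open>2 * k\<close> colours, and the complement of \<open>S\<close> still contains
  one.\<close>

lemma g_le_uniform_blocks:
  assumes "r < 2 * k" "s + k \<le> r"
  shows "g n r s \<le> n - n div (r choose k)"
proof -
  let ?K = "nsets {..<r} k" and ?N = "r choose k"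
  have "card ?K = ?N" by (simp add: card_nsets)
  then obtain B where B: "bij_betw B {..<?N} ?K"
    using ex_bij_betw_nat_finite[of ?K] by (auto simp: finite_imp_finite_nsets atLeast0LessThan)
  have BK: "B i \<subseteq> {..<r}" "card (B i) = k" if "i < ?N" for i
    using bij_betw_apply[OF B, of i] that by (auto simp: nsets_def)
  have "g n r s \<le> n - 1 * (n div ?N)"
  proof (rule g_le_blocks)
    show "?N > 0" using assms by simp
  next
    fix i j assume ij: "i < ?N" "j < ?N"
    show "B i \<inter> B j \<noteq> {}"
    proof
      assume "B i \<inter> B j = {}"
      then have "card (B i \<union> B j) = 2 * k"
        using BK[OF ij(1)] BK[OF ij(2)] by (subst card_Un_disjoint) (auto intro: finite_subset)
      moreover have "card (B i \<union> B j) \<le> card {..<r}"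
        using BK[OF ij(1)] BK[OF ij(2)] by (intro card_mono) auto
      ultimately show False using assms(1) by simp
    qed
  next
    fix S assume S: "S \<subseteq> {..<r}" "card S \<le> s"
    then have "card ({..<r} - S) \<ge> k"
      using assms(2) by (subst card_Diff_subset) (auto intro: finite_subset)
    then obtain T where T: "T \<subseteq> {..<r} - S" "card T = k"
      by (meson obtain_subset_with_card_n)
    then have "T \<in> ?K" by (auto simp: nsets_def intro: finite_subset)
    then obtain i where "i < ?N" "B i = T" using B by (metis bij_betw_def imageE lessThan_iff)
    then have "i \<in> {i \<in> {..<?N}. B i \<inter> S = {}}" using T by auto
    then show "1 \<le> card {i \<in> {..<?N}. B i \<inter> S = {}}"
      by (auto simp: Suc_le_eq card_gt_0_iff)
  qed (use BK in auto)
  then show ?thesis by simp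
qed

lemma card_filter_nth: "card {i \<in> {..<length xs}. P (xs ! i)} = length (filter P xs)"
  by (simp add: length_filter_conv_card)

text \<open>Lists allow repeated blocks, that is, unequal shares of vertices, and make concrete
  families checkable by simplification.\<close>

lemma g_le_list:
  fixes Bs :: "nat list list"
  assumes "Bs \<noteq> []" "\<forall>X\<in>set Bs. set X \<subseteq> {..<r}"
    and "\<forall>X\<in>set Bs. \<forall>Y\<in>set Bs. set X \<inter> set Y \<noteq> {}"
    and "\<And>S. S \<subseteq> {..<r} \<Longrightarrow> card S \<le> s \<Longrightarrow> u \<le> length (filter (\<lambda>X. set X \<inter> S = {}) Bs)"
  shows "g n r s \<le> n - u * (n div length Bs)"
proof (rule g_le_blocks[where B = "\<lambda>i. set (Bs ! i)"])
  fix S assume S: "S \<subseteq> {..<r}" "card S \<le> s"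
  show "u \<le> card {i \<in> {..<length Bs}. set (Bs ! i) \<inter> S = {}}"
    using assms(4)[OF S] card_filter_nth[of Bs "\<lambda>X. set X \<inter> S = {}"] by simp
next
  show "length Bs > 0" using assms(1) by simp
qed (use assms(2,3) nth_mem in \<open>blast+\<close>)

lemma g_one_le_list:
  fixes Bs :: "nat list list"
  assumes "Bs \<noteq> []" "\<forall>X\<in>set Bs. set X \<subseteq> {..<r}"
    and "\<forall>X\<in>set Bs. \<forall>Y\<in>set Bs. set X \<inter> set Y \<noteq> {}" and "r > 0"
    and u: "\<forall>a\<in>{..<r}. u \<le> length (filter (\<lambda>X. a \<notin> set X) Bs)"
  shows "g n r 1 \<le> n - u * (n div length Bs)"
proof (rule g_le_list[OF assms(1-3)])
  fix S assume S: "S \<subseteq> {..<r}" "card S \<le> 1"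
  have "finite S" using S finite_subset by blast
  obtain a where a: "a < r" "S \<subseteq> {a}"
  proof (cases "S = {}")
    case True
    then show ?thesis using that[of 0] assms(4) by simp
  next
    case False
    then have "card S = 1" using S \<open>finite S\<close> by (simp add: le_Suc_eq)
    then show ?thesis using that S by (auto simp: card_1_singleton_iff)
  qed
  have "u \<le> length (filter (\<lambda>X. a \<notin> set X) Bs)" using u a by simp
  also have "\<dots> \<le> length (filter (\<lambda>X. set X \<inter> S = {}) Bs)"
    unfolding card_filter_nth[symmetric] using a by (intro card_mono) auto
  finally show "u \<le> length (filter (\<lambda>X. set X \<inter> S = {}) Bs)" .
qed

lemma g_two_le_list:
  fixes Bs :: "nat list list"
  assumes "Bs \<noteq> []" "\<forall>X\<in>set Bs. set X \<subseteq> {..<r}"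
    and "\<forall>X\<in>set Bs. \<forall>Y\<in>set Bs. set X \<inter> set Y \<noteq> {}" and "r > 0"
    and u: "\<forall>a\<in>{..<r}. \<forall>b\<in>{..<r}. u \<le> length (filter (\<lambda>X. a \<notin> set X \<and> b \<notin> set X) Bs)"
  shows "g n r 2 \<le> n - u * (n div length Bs)"
proof (rule g_le_list[OF assms(1-3)])
  fix S assume S: "S \<subseteq> {..<r}" "card S \<le> 2"
  have "finite S" using S finite_subset by blast
  \<comment> \<open>Enlarging \<open>S\<close> only lowers the number of missed blocks, so pairs
    suffice; \<open>a = b\<close> is allowed for smaller \<open>S\<close>.\<close>
  obtain a b where ab: "a < r" "b < r" "S \<subseteq> {a, b}"
  proof -
    consider "S = {}" | "card S = 1" | "card S = 2"
      using S \<open>finite S\<close> by (auto simp: le_Suc_eq numeral_2_eq_2)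
    then show ?thesis
    proof cases
      case 1 then show ?thesis using that[of 0 0] assms(4) by simp
    next
      case 2 then show ?thesis using that S by (auto simp: card_1_singleton_iff)
    next
      case 3 then show ?thesis using that S by (auto simp: card_2_iff)
    qed
  qed
  have "u \<le> length (filter (\<lambda>X. a \<notin> set X \<and> b \<notin> set X) Bs)" using u ab by simp
  also have "\<dots> \<le> length (filter (\<lambda>X. set X \<inter> S = {}) Bs)"
    unfolding card_filter_nth[symmetric] using ab by (intro card_mono) auto
  finally show "u \<le> length (filter (\<lambda>X. set X \<inter> S = {}) Bs)" .
qed

section \<open>The explicit families\<close>

text \<open>The multiplicities 1, 1, 3, 2, 2 put every colour in exactly five of the nine
  blocks.\<close>

lemma g_five_one_le: "g n 5 1 \<le> n - 4 * (n div 9)"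
  using g_one_le_list[of "[[0,1],[0,2],[0,3,4],[0,3,4],[0,3,4],[1,2,3],[1,2,3],[1,2,4],[1,2,4]]" 5 4 n]
  by (simp add: lessThan_nat_numeral)

text \<open>Colours are the edges of the complete graph on four points and blocks are its stars: two
  stars share an edge, and each edge misses two stars.\<close>

lemma g_six_one_le: "g n 6 1 \<le> n - 2 * (n div 4)"
  using g_one_le_list[of "[[0,1,2],[0,3,4],[1,3,5],[2,4,5]]" 6 2 n]
  by (simp add: lessThan_nat_numeral)

text \<open>In the 2-(6,3,2) design each point lies in 5 of 10 blocks and each pair in 2, so two
  points miss 10 - 5 - 5 + 2 = 2 blocks.\<close>

lemma g_six_two_le: "g n 6 2 \<le> n - 2 * (n div 10)"
  using g_two_le_list[of "[[0,1,2],[0,2,3],[0,3,4],[0,4,5],[0,1,5],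
      [1,2,4],[2,3,5],[1,3,4],[2,4,5],[1,3,5]]" 6 2 n]
  by (simp add: lessThan_nat_numeral)

definition fano :: "nat list list" where
  "fano = [[0,1,2],[0,3,4],[0,5,6],[1,3,5],[1,4,6],[2,3,6],[2,4,5]]"

lemma g_seven_one_le: "g n 7 1 \<le> n - 4 * (n div 7)"
  using g_one_le_list[of fano 7 4 n] by (simp add: fano_def lessThan_nat_numeral)

text \<open>Two points of the Fano plane lie on three lines each and share one, so they miss 7 - 3 -
  3 + 1 = 2 lines.\<close>

lemma g_seven_two_le: "g n 7 2 \<le> n - 2 * (n div 7)"
  using g_two_le_list[of fano 7 2 n] by (simp add: fano_def lessThan_nat_numeral)

section \<open>Numerical values and assembly\<close>

lemma choose_values:
  "5 choose 2 = (10::nat)" "5 choose 3 = (10::nat)" "6 choose 2 = (15::nat)" "6 choose 3 = (20::nat)"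
  "7 choose 2 = (21::nat)" "7 choose 3 = (35::nat)" "7 choose 4 = (35::nat)"
  "2 choose 2 = (1::nat)" "Suc 0 choose 3 = (0::nat)" "3 choose 2 = (3::nat)" "2 choose 3 = (0::nat)"
  "4 choose 2 = (6::nat)" "3 choose 3 = (1::nat)" "2 choose 4 = (0::nat)"
  by (simp_all add: choose_two eval_nat_numeral)

lemma ceiling_eq_diff_div:
  assumes "N > 0"
  shows "\<lceil>(real N - 1) / real N * real n\<rceil> = int (n - n div N)"
proof -
  have "real n = real (n div N) * real N + real (n mod N)"
    by (metis div_mult_mod_eq of_nat_add of_nat_mult)
  moreover have "real (n mod N) < real N" using assms by simp
  moreover have "real (n - n div N) = real n - real (n div N)"
    by (simp add: of_nat_diff div_le_dividend)
  ultimately show ?thesis using assms by (intro ceiling_unique) (auto simp: field_simps)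
qed

theorem theorem2p12:
  fixes n :: nat
  assumes "n \<ge> 2"
  shows
    "(9 dvd n \<longrightarrow> real (g n 5 1) = 5 / 9 * real n) \<and>
     int (g n 5 2) = \<lceil>9 / 10 * real n\<rceil> \<and>
     (\<forall>s\<ge>3. g n 5 s = n) \<and>
     (4 dvd n \<longrightarrow> real (g n 6 1) = 1 / 2 * real n) \<and>
     (10 dvd n \<longrightarrow> real (g n 6 2) = 4 / 5 * real n) \<and>
     (\<forall>s\<ge>3. g n 6 s = n) \<and>
     (7 dvd n \<longrightarrow> real (g n 7 1) = 3 / 7 * real n) \<and>
     (7 dvd n \<longrightarrow> real (g n 7 2) = 5 / 7 * real n) \<and>
     int (g n 7 3) = \<lceil>34 / 35 * real n\<rceil> \<and>
     (\<forall>s>3. g n 7 s = n)"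
proof (intro conjI impI allI)
  assume "9 dvd n"
  then obtain k where k: "n = 9 * k" by auto
  have "g n 5 1 = 5 * k"
    using g_five_one_ge[OF assms, of "5 * k"] g_five_one_le[of n] by (simp add: k)
  then show "real (g n 5 1) = 5 / 9 * real n" by (simp add: k)
next
  have "g n 5 2 \<le> n - n div 10"
    using g_le_uniform_blocks[of 5 3 2 n] by (simp add: choose_values)
  moreover have "n - n div 10 \<le> g n 5 2"
  proof (rule g_ge_binomial[where t = 2])
    show "(5 choose 2) * (n - n div 10) < ((5 choose 2) - ((5 - Suc 2) choose 2)) * n + (5 choose 2)"
      by (simp add: choose_values)
  qed (use assms in auto)
  ultimately show "int (g n 5 2) = \<lceil>9 / 10 * real n\<rceil>"
    using ceiling_eq_diff_div[of 10 n] by simp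
next
  fix s :: nat assume "3 \<le> s"
  \<comment> \<open>Three colours always meet a palette of at least four among five, so the
    subtracted binomial is 0 and the average is \<open>n\<close>. The same happens below for six
    colours with \<open>t = 3\<close> and for seven with \<open>t = 4\<close>.\<close>
  then have "n \<le> g n 5 s"
    using assms by (intro g_ge_binomial[where t = 3]) (auto simp: choose_values)
  then show "g n 5 s = n" using g_le_n[of 5 n s] by simp
next
  assume "4 dvd n"
  then obtain k where k: "n = 4 * k" by auto
  have "g n 6 1 = 2 * k"
    using g_one_ge[OF assms, of 6 "2 * k"] g_six_one_le[of n] by (simp add: k)
  then show "real (g n 6 1) = 1 / 2 * real n" by (simp add: k)
next
  assume "10 dvd n"
  then obtain k where k: "n = 10 * k" by auto
  \<comment> \<open>The average is (15 - 3) / 15 = 4/5.\<close>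
  have "8 * k \<le> g n 6 2"
    using assms by (intro g_ge_binomial[where t = 2]) (auto simp: choose_values k)
  then have "g n 6 2 = 8 * k" using g_six_two_le[of n] by (simp add: k)
  then show "real (g n 6 2) = 4 / 5 * real n" by (simp add: k)
next
  fix s :: nat assume "3 \<le> s"
  then have "n \<le> g n 6 s"
    using assms by (intro g_ge_binomial[where t = 3]) (auto simp: choose_values)
  then show "g n 6 s = n" using g_le_n[of 6 n s] by simp
next
  assume "7 dvd n"
  then obtain k where k: "n = 7 * k" by auto
  have "g n 7 1 = 3 * k"
    using g_one_ge[OF assms, of 7 "3 * k"] g_seven_one_le[of n] by (simp add: k)
  then show "real (g n 7 1) = 3 / 7 * real n" by (simp add: k)
next
  assume "7 dvd n"
  then obtain k where k: "n = 7 * k" by auto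
  \<comment> \<open>The average is (21 - 6) / 21 = 5/7.\<close>
  have "5 * k \<le> g n 7 2"
    using assms by (intro g_ge_binomial[where t = 2]) (auto simp: choose_values k)
  then have "g n 7 2 = 5 * k" using g_seven_two_le[of n] by (simp add: k)
  then show "real (g n 7 2) = 5 / 7 * real n" by (simp add: k)
next
  have "g n 7 3 \<le> n - n div 35"
    using g_le_uniform_blocks[of 7 4 3 n] by (simp add: choose_values)
  moreover have "n - n div 35 \<le> g n 7 3"
  proof (rule g_ge_binomial[where t = 3])
    show "(7 choose 3) * (n - n div 35) < ((7 choose 3) - ((7 - Suc 3) choose 3)) * n + (7 choose 3)"
      by (simp add: choose_values)
  qed (use assms in auto)
  ultimately show "int (g n 7 3) = \<lceil>34 / 35 * real n\<rceil>"
    using ceiling_eq_diff_div[of 35 n] by simp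
next
  fix s :: nat assume "s > 3"
  then have "n \<le> g n 7 s"
    using assms by (intro g_ge_binomial[where t = 4]) (auto simp: choose_values)
  then show "g n 7 s = n" using g_le_n[of 7 n s] by simp
qed

end
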